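(* If $f \in \mathcal{M}_1(1)$, then the radii $B_f(1)$ and $L_f(1)$ are infinite, i.e. $B_f(1)=L_f(1)=\infty$.
   Context: Let $\mathbb{D}=\{z\in\mathbb{C}:|z|<1\}$. For $\lambda\in\overline{\mathbb{D}}\setminus\{0\}$, $\mathcal{M}_1(\lambda)$ is the class of all meromorphic functions $f$ in $\mathbb{D}$ having a simple pole at $\lambda$, analytic at all other points of $\mathbb{D}$, and normalized by $f'(0)=1$. In particular, for $\lambda\in\partial\mathbb{D}$ the function $f$ is analytic in all of $\mathbb{D}$, and having a simple pole at $\lambda$ means that near $\lambda$ one has $f(z)=h(z)/(z-\lambda)$ with $h$ analytic at $\lambda$ and $h(\lambda)\neq 0$. For $f\in\mathcal{M}_1(\lambda)$, $L_f(\lambda)$ is the radius of the largest disk contained in $f(\mathbb{D})$, i.e. the supremum in $[0,\infty]$ of the radii of open Euclidean disks in $\mathbb{C}$ contained in $f(\mathbb{D})$. $B_f(\lambda)$ is the radius of the largest schlicht disk contained in $f(\mathbb{D})$, i.e. the supremum in $[0,\infty]$ of the radii of schlicht disks, where a schlicht disk is an open Euclidean disk $\Delta\subset\mathbb{C}$ for which there is a subdomain $U\subset\mathbb{D}$ such that $f$ is univalent on $U$ and $f(U)=\Delta$. *)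

theory Defs
  imports "HOL-Complex_Analysis.Complex_Analysis"
begin

text \<open>
  The local form of \<open>f\<close> is only required at points of the unit disc near \<open>p\<close>, so that one
  definition covers poles in the disc (where it is the usual notion of a simple pole) and
  poles on the unit circle (where values of \<open>f\<close> outside the disc must play no role).
\<close>

definition simple_pole_disc :: "(complex \<Rightarrow> complex) \<Rightarrow> complex \<Rightarrow> bool" where
  "simple_pole_disc f p \<longleftrightarrow>
     (\<exists>h. h analytic_on {p} \<and> h p \<noteq> 0 \<and>
          (\<forall>\<^sub>F z in at p within ball 0 1. f z = h z / (z - p)))"

definition M1 :: "complex \<Rightarrow> (complex \<Rightarrow> complex) set" where
  "M1 p = {f. p \<in> cball 0 1 - {0} \<and> f holomorphic_on (ball 0 1 - {p}) \<and>
              simple_pole_disc f p \<and> deriv f 0 = 1}"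

text \<open>
  The point \<open>p\<close> is removed from the disc because there \<open>f\<close> takes the value infinity, which
  lies in no Euclidean disc, whereas the HOL value \<open>f p\<close> is arbitrary. For \<open>p\<close> on the unit
  circle nothing is removed. Suprema are taken in \<^typ>\<open>ennreal\<close>, i.e. in \<open>[0,\<infinity>]\<close>.
\<close>

definition L_radius :: "(complex \<Rightarrow> complex) \<Rightarrow> complex \<Rightarrow> ennreal" where
  "L_radius f p = Sup {ennreal r | r. r > 0 \<and> (\<exists>w. ball w r \<subseteq> f ` (ball 0 1 - {p}))}"

definition schlicht_disc :: "(complex \<Rightarrow> complex) \<Rightarrow> complex \<Rightarrow> complex \<Rightarrow> real \<Rightarrow> bool" where
  "schlicht_disc f p w r \<longleftrightarrow> r > 0 \<and>
     (\<exists>U. open U \<and> connected U \<and> U \<noteq> {} \<and> U \<subseteq> ball 0 1 - {p} \<and>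
          f holomorphic_on U \<and> inj_on f U \<and> f ` U = ball w r)"

definition B_radius :: "(complex \<Rightarrow> complex) \<Rightarrow> complex \<Rightarrow> ennreal" where
  "B_radius f p = Sup {ennreal r | r. \<exists>w. schlicht_disc f p w r}"

end

theory Submission imports Defs begin

text \<open>
  In the coordinate \<open>\<omega> = 1 / (1 - z)\<close> the unit disc becomes the half-plane \<open>Re \<omega> > 1/2\<close>, and
  the simple pole at \<open>1\<close> moves to infinity. Expanding the numerator of \<open>f z = h z / (z - 1)\<close>
  to first order gives \<open>f = - c \<omega> + k z\<close>, with \<open>c = h 1 \<noteq> 0\<close> and \<open>k\<close> bounded and Lipschitz
  near \<open>1\<close>: in the new coordinate \<open>f\<close> is an affine bijection plus a perturbation that is bounded and
  whose Lipschitz constant tends to \<open>0\<close> as \<open>Re \<omega> \<rightarrow> \<infinity>\<close>. Hence on a half-plane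
  \<open>Re \<omega> > T\<close> far to the right (a horodisc at \<open>1\<close> in the old coordinate) \<open>f\<close> is univalent,
  because the perturbation cannot cancel differences of the affine part, and its image
  contains a half-plane, by Brouwer's fixed point theorem. A half-plane contains discs of every radius, and each of
  them pulls back through the inverse of \<open>f\<close> to a domain on which \<open>f\<close> is univalent.
\<close>

section \<open>First-order expansion of the numerator\<close>

text \<open>
  The divided difference of an analytic function is analytic, so its derivative is bounded
  near \<open>p\<close>. The factor in this first-order expansion is therefore Lipschitz and bounded,
  which is all that is used about the numerator of a simple pole.
\<close>

lemma analytic_at_first_order_Lipschitz:
  fixes h :: "complex \<Rightarrow> complex"
  assumes "h analytic_on {p}"
  obtains k :: "complex \<Rightarrow> complex" and \<delta> M K :: real
  where "\<delta> > 0" "M \<ge> 0" "K \<ge> 0"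
    and "\<And>z. z \<in> ball p \<delta> \<Longrightarrow> h z = h p + (z - p) * k z"
    and "\<And>z. z \<in> ball p \<delta> \<Longrightarrow> norm (k z) \<le> K"
    and "\<And>x y. \<lbrakk>x \<in> ball p \<delta>; y \<in> ball p \<delta>\<rbrakk> \<Longrightarrow> norm (k x - k y) \<le> M * norm (x - y)"
proof -
  obtain \<epsilon> where \<epsilon>: "\<epsilon> > 0" "h holomorphic_on ball p \<epsilon>"
    using assms by (auto simp: analytic_on_def)
  define k where "k z = (if z = p then deriv h p else (h z - h p) / (z - p))" for z
  have holk: "k holomorphic_on ball p \<epsilon>"
    unfolding k_def using \<epsilon>(2) by (rule pole_lemma_open) simp
  have sub: "cball p (\<epsilon>/2) \<subseteq> ball p \<epsilon>"
    using \<epsilon> by auto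
  have bdd: "\<exists>B\<ge>0. \<forall>z\<in>cball p (\<epsilon>/2). norm (g z) \<le> B"
    if "g holomorphic_on ball p \<epsilon>" for g :: "complex \<Rightarrow> complex"
  proof -
    have "bounded (g ` cball p (\<epsilon>/2))"
      using that sub
      by (meson compact_imp_bounded compact_cball compact_continuous_image continuous_on_subset
          holomorphic_on_imp_continuous_on)
    then show ?thesis
      unfolding bounded_pos by (blast intro: less_imp_le)
  qed
  obtain K where K: "K \<ge> 0" "\<And>z. z \<in> cball p (\<epsilon>/2) \<Longrightarrow> norm (k z) \<le> K"
    using bdd[OF holk] by blast
  obtain M where M: "M \<ge> 0" "\<And>z. z \<in> cball p (\<epsilon>/2) \<Longrightarrow> norm (deriv k z) \<le> M"
    using bdd[OF holomorphic_deriv[OF holk open_ball]] by blast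
  have "norm (k x - k y) \<le> M * norm (x - y)"
    if "x \<in> ball p (\<epsilon>/2)" "y \<in> ball p (\<epsilon>/2)" for x y
  proof (rule field_differentiable_bound[of "ball p (\<epsilon>/2)" k "deriv k" M])
    fix z assume z: "z \<in> ball p (\<epsilon>/2)"
    show "(k has_field_derivative deriv k z) (at z within ball p (\<epsilon>/2))"
      using z sub holk
      by (meson ball_subset_cball holomorphic_derivI open_ball subsetD has_field_derivative_at_within)
    show "norm (deriv k z) \<le> M"
      using z M by auto
  qed (use that in auto)
  then show ?thesis
    using \<epsilon> K M by (intro that[of "\<epsilon>/2" M K k]) (auto simp: k_def)
qed

section \<open>Horodiscs at 1\<close>

text \<open>
  For \<open>T > 0\<close> this is the open disc with diameter from \<open>1 - 1/T\<close> to \<open>1\<close>. Describing it by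
  \<open>1 / (1 - z)\<close> makes it a half-plane in the coordinate in which the pole lies at infinity;
  since \<open>1 / 0 = 0\<close>, the point \<open>1\<close> itself is left out for \<open>T \<ge> 0\<close>.
\<close>

definition horodisc :: "real \<Rightarrow> complex set" where
  "horodisc T = {z. Re (1 / (1 - z)) > T}"

lemma open_horodisc:
  assumes "T \<ge> 0"
  shows "open (horodisc T)"
proof -
  have "open {z \<in> - {1::complex}. Re (1 / (1 - z)) \<in> {T<..}}"
    by (rule continuous_open_preimage[unfolded vimage_def Int_def, simplified])
       (auto intro!: continuous_intros)
  moreover have "horodisc T = {z \<in> - {1}. Re (1 / (1 - z)) \<in> {T<..}}"
    using assms by (auto simp: horodisc_def)
  ultimately show ?thesis by simp
qed

lemma norm_inverse_ge_on_horodisc: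
  assumes "z \<in> horodisc T"
  shows "T < norm (1 / (1 - z))"
  using assms complex_Re_le_cmod[of "1 / (1 - z)"] by (auto simp: horodisc_def)

lemma horodisc_subset_ball:
  assumes "T > 0"
  shows "horodisc T \<subseteq> ball 1 (1 / T) - {1}"
proof
  fix z assume z: "z \<in> horodisc T"
  then have "z \<noteq> 1" using assms by (auto simp: horodisc_def)
  moreover have "norm (1 - z) < 1 / T"
    using norm_inverse_ge_on_horodisc[OF z] assms \<open>z \<noteq> 1\<close>
    by (simp add: norm_divide field_simps)
  ultimately show "z \<in> ball 1 (1 / T) - {1}" by (simp add: dist_norm)
qed

text \<open>
  With \<open>\<omega> = 1 / (1 - z)\<close> one has \<open>z = (\<omega> - 1) / \<omega>\<close>, and \<open>Re \<omega> > 1/2\<close> says that \<open>\<omega>\<close> is closer to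
  \<open>1\<close> than to \<open>0\<close>.
\<close>

lemma horodisc_subset_unit_disc:
  assumes "T \<ge> 1/2"
  shows "horodisc T \<subseteq> ball 0 1"
proof
  fix z assume z: "z \<in> horodisc T"
  define \<omega> where "\<omega> = 1 / (1 - z)"
  have Re: "Re \<omega> > 1/2" using z assms by (auto simp: horodisc_def \<omega>_def)
  then have "\<omega> \<noteq> 0" by auto
  have "(norm (\<omega> - 1))\<^sup>2 < (norm \<omega>)\<^sup>2"
    using Re unfolding cmod_power2 by (simp add: power2_eq_square algebra_simps)
  then have "norm (\<omega> - 1) < norm \<omega>"
    by (rule power2_less_imp_less) simp
  moreover have "z = (\<omega> - 1) / \<omega>"
    using \<open>\<omega> \<noteq> 0\<close> by (auto simp: \<omega>_def field_simps)
  ultimately show "z \<in> ball 0 1"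
    using \<open>\<omega> \<noteq> 0\<close> by (simp add: norm_divide)
qed

section \<open>Perturbations of affine maps on a half-plane\<close>

text \<open>
  Solving \<open>\<omega> + e \<omega> = a\<close> means finding a fixed point of \<open>\<lambda>\<omega>. a - e \<omega>\<close>, which maps the closed
  disc of radius \<open>K\<close> about \<open>a\<close> into itself; the condition on \<open>Re a\<close> keeps that disc
  inside the half-plane.
\<close>

lemma bounded_perturbation_covers_half_plane:
  fixes e :: "complex \<Rightarrow> complex"
  assumes cont: "continuous_on {\<omega>. Re \<omega> > T} e"
    and bound: "\<And>\<omega>. Re \<omega> > T \<Longrightarrow> norm (e \<omega>) \<le> K"
    and "K \<ge> 0" and a: "Re a > T + K"
  obtains \<omega> where "Re \<omega> > T" "\<omega> + e \<omega> = a"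
proof -
  have sub: "cball a K \<subseteq> {\<omega>. Re \<omega> > T}"
  proof
    fix \<omega> assume "\<omega> \<in> cball a K"
    then have "Re (a - \<omega>) \<le> K"
      using complex_Re_le_cmod[of "a - \<omega>"] by (simp add: dist_norm)
    then show "\<omega> \<in> {\<omega>. Re \<omega> > T}" using a by simp
  qed
  have "continuous_on (cball a K) (\<lambda>\<omega>. a - e \<omega>)"
    using sub cont by (intro continuous_intros) (rule continuous_on_subset)
  moreover have "(\<lambda>\<omega>. a - e \<omega>) \<in> cball a K \<rightarrow> cball a K"
    using sub bound by (force simp: dist_norm)
  ultimately obtain \<omega> where "\<omega> \<in> cball a K" "a - e \<omega> = \<omega>"
    using brouwer[of "cball a K" "\<lambda>\<omega>. a - e \<omega>"] \<open>K \<ge> 0\<close> by auto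
  then show thesis
    using sub that[of \<omega>] by (auto simp: algebra_simps)
qed

text \<open>
  Univalence on a horodisc follows from
  \<open>x - y = (\<omega> x - \<omega> y) / (\<omega> x * \<omega> y)\<close>, where \<open>\<omega> z = 1 / (1 - z)\<close>: an \<open>M\<close>-Lipschitz function of \<open>z\<close>
  has Lipschitz constant at most \<open>M / T\<^sup>2\<close> as a function of \<open>\<omega>\<close>.
\<close>

lemma inj_on_horodisc:
  fixes k :: "complex \<Rightarrow> complex"
  assumes "T > 0" and "M \<ge> 0" and "M < norm c * T\<^sup>2"
    and lip: "\<And>x y. \<lbrakk>x \<in> horodisc T; y \<in> horodisc T\<rbrakk> \<Longrightarrow> norm (k x - k y) \<le> M * norm (x - y)"
  shows "inj_on (\<lambda>z. k z - c * (1 / (1 - z))) (horodisc T)"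
proof (rule inj_onI)
  fix x y
  assume xy: "x \<in> horodisc T" "y \<in> horodisc T"
    and eq: "k x - c * (1 / (1 - x)) = k y - c * (1 / (1 - y))"
  define u v where "u = 1 / (1 - x)" and "v = 1 / (1 - y)"
  have ne: "x \<noteq> 1" "y \<noteq> 1" using xy horodisc_subset_ball[OF \<open>T > 0\<close>] by auto
  have T: "T < norm u" "T < norm v"
    using xy norm_inverse_ge_on_horodisc by (auto simp: u_def v_def)
  have uv: "x - y = (u - v) / (u * v)"
    using ne by (simp add: u_def v_def divide_simps)
  have "T\<^sup>2 \<le> norm (u * v)"
    using T \<open>T > 0\<close> by (auto simp: norm_mult power2_eq_square intro: mult_mono)
  have "k x - k y = c * (u - v)"
    using eq unfolding u_def[symmetric] v_def[symmetric] by (simp add: algebra_simps)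
  then have "norm c * norm (u - v) = norm (k x - k y)"
    by (simp add: norm_mult)
  also have "\<dots> \<le> M * (norm (u - v) / norm (u * v))"
    using lip[OF xy] by (simp add: uv norm_divide)
  also have "\<dots> \<le> M * (norm (u - v) / T\<^sup>2)"
    using \<open>T\<^sup>2 \<le> norm (u * v)\<close> \<open>T > 0\<close> \<open>M \<ge> 0\<close>
    by (intro mult_left_mono divide_left_mono) (auto intro!: mult_pos_pos)
  finally have "(norm c * T\<^sup>2) * norm (u - v) \<le> M * norm (u - v)"
    using \<open>T > 0\<close> by (simp add: field_simps)
  then have "\<not> 0 < norm (u - v)"
    using mult_strict_right_mono[OF \<open>M < norm c * T\<^sup>2\<close>, of "norm (u - v)"] by linarith
  then have "u = v" by simp
  then show "x = y" using ne uv by simp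
qed

section \<open>Schlicht discs near the pole\<close>

text \<open>
  Since the inverse of a univalent function is continuous, every disc in the
  image of a domain of univalence is schlicht.
\<close>

lemma schlicht_disc_of_inj_on:
  assumes "f holomorphic_on S" "open S" "inj_on f S" "S \<subseteq> ball 0 1 - {p}"
    and "r > 0" "ball w r \<subseteq> f ` S"
  shows "schlicht_disc f p w r"
proof -
  obtain g where g: "g holomorphic_on f ` S" "\<And>z. z \<in> S \<Longrightarrow> g (f z) = z"
    using holomorphic_has_inverse[OF assms(1-3)] by metis
  define U where "U = g ` ball w r"
  have "U \<subseteq> S" using g assms(6) by (auto simp: U_def)
  have cont: "continuous_on (ball w r) g"
    using g assms(6) continuous_on_subset holomorphic_on_imp_continuous_on by blast
  have "U = S \<inter> f -` ball w r"
    using g assms(6) by (force simp: U_def)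
  then have "open U"
    using assms(1,2) by (simp add: continuous_open_preimage holomorphic_on_imp_continuous_on)
  moreover have "connected U"
    unfolding U_def by (intro connected_continuous_image cont connected_ball)
  moreover have "f ` U = ball w r"
    using g assms(6) by (force simp: U_def image_image)
  moreover have "f holomorphic_on U" "inj_on f U" "U \<subseteq> ball 0 1 - {p}" "U \<noteq> {}"
    using \<open>U \<subseteq> S\<close> assms by (auto intro: holomorphic_on_subset inj_on_subset simp: U_def)
  ultimately show ?thesis
    using \<open>r > 0\<close> unfolding schlicht_disc_def by blast
qed

text \<open>
  The horodisc depends only on \<open>f\<close>; for larger \<open>r\<close> the centre \<open>w\<close> moves farther into the half-plane
  that the image contains, in the direction \<open>- c\<close>.
\<close>

lemma schlicht_discs_at_boundary_pole:
  assumes "f holomorphic_on ball 0 1" and "simple_pole_disc f 1" and "r > 0"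
  obtains w where "schlicht_disc f 1 w r"
proof -
  obtain h where h: "h analytic_on {1}" "h 1 \<noteq> 0"
      and ev: "\<forall>\<^sub>F z in at 1 within ball 0 1. f z = h z / (z - 1)"
    using assms(2) by (auto simp: simple_pole_disc_def)
  define c where "c = h 1"
  have "c \<noteq> 0" using h by (simp add: c_def)
  obtain k \<delta> M K where k: "\<delta> > 0" "M \<ge> 0" "K \<ge> 0"
      "\<And>z. z \<in> ball 1 \<delta> \<Longrightarrow> h z = c + (z - 1) * k z"
      "\<And>z. z \<in> ball 1 \<delta> \<Longrightarrow> norm (k z) \<le> K"
      "\<And>x y. \<lbrakk>x \<in> ball 1 \<delta>; y \<in> ball 1 \<delta>\<rbrakk> \<Longrightarrow> norm (k x - k y) \<le> M * norm (x - y)"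
    using analytic_at_first_order_Lipschitz[OF h(1)] unfolding c_def by metis
  obtain \<eta> where \<eta>: "\<eta> > 0"
      "\<And>z. \<lbrakk>z \<in> ball 0 1; z \<noteq> 1; dist z 1 < \<eta>\<rbrakk> \<Longrightarrow> f z = h z / (z - 1)"
    using ev unfolding eventually_at by blast
  \<comment> \<open>The first summand puts the horodisc into the unit disc, the next two put it where the
      expansion of \<open>h\<close> and the local form of \<open>f\<close> hold, and the last yields
      \<open>M < norm c * T\<^sup>2\<close> because \<open>T \<le> T\<^sup>2\<close>.\<close>
  define T where "T = 1 + 1 / \<delta> + 1 / \<eta> + M / norm c"
  have T: "T \<ge> 1" "1 / \<delta> \<le> T" "1 / \<eta> \<le> T" "M / norm c < T"
    using k(1,2) \<eta>(1) by (auto simp: T_def add_pos_nonneg add_nonneg_nonneg)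
  have "T > 0" using T by simp
  have small: "1 / T \<le> \<delta>" "1 / T \<le> \<eta>"
    using T k(1) \<eta>(1) \<open>T > 0\<close> by (auto simp: field_simps)
  define S where "S = horodisc T"
  have S: "S \<subseteq> ball 0 1" "S \<subseteq> ball 1 \<delta>" "1 \<notin> S" "S \<subseteq> ball 1 \<eta>" "open S"
    using horodisc_subset_unit_disc[of T] horodisc_subset_ball[OF \<open>T > 0\<close>] T small
      open_horodisc[of T] unfolding S_def by (auto simp: subset_iff)
  have f_eq: "f z = k z - c * (1 / (1 - z))" if "z \<in> S" for z
  proof -
    have "z \<noteq> 1" using that S by auto
    have "f z = h z / (z - 1)"
      using that S \<eta>(2)[of z] \<open>z \<noteq> 1\<close> by (auto simp: dist_commute subset_iff)
    also have "\<dots> = (c + (z - 1) * k z) / (z - 1)"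
      using k(4) that S by auto
    also have "\<dots> = k z - c * (1 / (1 - z))"
      using \<open>z \<noteq> 1\<close> by (simp add: divide_simps) (simp add: algebra_simps)
    finally show ?thesis .
  qed
  have "M < norm c * T"
    using T(4) \<open>c \<noteq> 0\<close> by (simp add: field_simps)
  also have "\<dots> \<le> norm c * T\<^sup>2"
    using T(1) by (intro mult_left_mono) (auto simp: power2_eq_square)
  finally have "inj_on (\<lambda>z. k z - c * (1 / (1 - z))) S"
    unfolding S_def using k(2,6) S(2) \<open>T > 0\<close>
    by (intro inj_on_horodisc[where M = M]) (auto simp: S_def subset_iff)
  then have inj: "inj_on f S"
    using f_eq by (simp cong: inj_on_cong)
  have holf: "f holomorphic_on S"
    using assms(1) S(1) by (rule holomorphic_on_subset)
  \<comment> \<open>The centre is the value of the affine part at a point \<open>\<omega>\<close> so far to the right that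
      the disc of radius \<open>(K + r) / norm c\<close> about it stays in the half-plane.\<close>
  define w0 where "w0 = - c * of_real (T + (K + r) / norm c + 1)"
  define e where "e \<omega> = - k (1 - 1 / \<omega>) / c" for \<omega>
  have inS: "1 - 1 / \<omega> \<in> S" if "Re \<omega> > T" for \<omega>
    using that by (simp add: S_def horodisc_def)
  have "ball w0 r \<subseteq> f ` S"
  proof
    fix w assume w: "w \<in> ball w0 r"
    have "continuous_on S k"
      by (rule continuous_on_subset[OF lipschitz_on_continuous_on[of M "ball 1 \<delta>"] S(2)])
         (use k in \<open>auto simp: lipschitz_on_def dist_norm\<close>)
    then have cont: "continuous_on {\<omega>. Re \<omega> > T} e"
      unfolding e_def using inS \<open>c \<noteq> 0\<close> \<open>T > 0\<close>
      by (intro continuous_intros) (auto elim!: continuous_on_compose2 intro!: continuous_intros)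
    have bound: "norm (e \<omega>) \<le> K / norm c" if "Re \<omega> > T" for \<omega>
    proof -
      have "norm (k (1 - 1 / \<omega>)) \<le> K"
        using k(5) inS[OF that] S(2) by blast
      then show ?thesis
        by (simp add: e_def norm_divide divide_right_mono)
    qed
    have "norm ((w - w0) / c) \<le> r / norm c"
      using w by (auto simp: norm_divide dist_norm norm_minus_commute intro: divide_right_mono)
    then have "Re ((w - w0) / c) \<le> r / norm c"
      using complex_Re_le_cmod order_trans by blast
    moreover have "- w / c = of_real (T + (K + r) / norm c + 1) - (w - w0) / c"
      using \<open>c \<noteq> 0\<close> by (simp add: w0_def field_simps)
    ultimately have "Re (- w / c) > T + K / norm c"
      by (simp add: add_divide_distrib)
    then obtain \<omega> where \<omega>: "Re \<omega> > T" "\<omega> + e \<omega> = - w / c"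
      using bounded_perturbation_covers_half_plane[OF cont bound] k(3)
      by (metis divide_nonneg_nonneg norm_ge_zero)
    have "f (1 - 1 / \<omega>) = k (1 - 1 / \<omega>) - c * \<omega>"
      using f_eq[OF inS[OF \<omega>(1)]] by simp
    also have "\<dots> = - c * (\<omega> + e \<omega>)"
      using \<open>c \<noteq> 0\<close> by (simp add: e_def field_simps)
    also have "\<dots> = w"
      using \<omega>(2) \<open>c \<noteq> 0\<close> by simp
    finally show "w \<in> f ` S"
      using inS[OF \<omega>(1)] by force
  qed
  then have "schlicht_disc f 1 w0 r"
    using S inj holf \<open>r > 0\<close> by (intro schlicht_disc_of_inj_on[of f S]) auto
  then show thesis by (rule that)
qed

lemma ennreal_Sup_eq_infinity:
  assumes "\<And>r. r > 0 \<Longrightarrow> ennreal r \<in> A"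
  shows "Sup A = \<infinity>"
proof -
  have "\<exists>a\<in>A. x < a" if "x < top" for x
  proof -
    obtain r where "r \<ge> 0" "x = ennreal r"
      using \<open>x < top\<close> by (cases x) auto
    then have "x < ennreal (r + 1)"
      by (simp add: ennreal_lessI)
    then show ?thesis
      using assms[of "r + 1"] \<open>r \<ge> 0\<close> by auto
  qed
  then show ?thesis
    unfolding infinity_ennreal_def Sup_eq_top_iff by blast
qed

theorem theorem2p1:
  fixes f :: "complex \<Rightarrow> complex"
  assumes "f \<in> M1 1"
  shows "B_radius f 1 = \<infinity> \<and> L_radius f 1 = \<infinity>"
proof -
  have "ball 0 1 - {1} = ball (0::complex) 1" by auto
  then have f: "f holomorphic_on ball 0 1" "simple_pole_disc f 1"
    using assms by (auto simp: M1_def)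
  have disc: "\<exists>w. schlicht_disc f 1 w r" if "r > 0" for r
    using schlicht_discs_at_boundary_pole[OF f that] by metis
  moreover have "\<exists>w. ball w r \<subseteq> f ` (ball 0 1 - {1})" if "r > 0" for r
    using disc[OF that] unfolding schlicht_disc_def by blast
  ultimately show ?thesis
    unfolding B_radius_def L_radius_def by (intro conjI ennreal_Sup_eq_infinity) blast+
qed

end
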